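(* Let $a\in\mathbb{R}$, $n\in\mathbb{Z}_+$, $\alpha\in(0,1)$, let $w:\mathbb{N}_a\to\mathbb{R}\setminus\{0\}$ satisfy $\frac{w(a)}{w(k)}>0$ for all $k\in\mathbb{N}_{a+1}$, and let $u,v:\mathbb{N}_a\to\mathbb{R}^n$ be synchronous. Then for all $k\in\mathbb{N}_{a+1}$, $${}_a^{\rm C}\nabla_k^{\alpha,w(k)}[u^{\rm T}(k)v(k)]+[u^{\rm T}(k)v(k)]\,{}_a^{\rm C}\nabla_k^{\alpha,w(k)}1\le u^{\rm T}(k)\,{}_a^{\rm C}\nabla_k^{\alpha,w(k)}v(k)+v^{\rm T}(k)\,{}_a^{\rm C}\nabla_k^{\alpha,w(k)}u(k),$$ $${}_a^{\rm R}\nabla_k^{\alpha,w(k)}[u^{\rm T}(k)v(k)]+[u^{\rm T}(k)v(k)]\,{}_a^{\rm R}\nabla_k^{\alpha,w(k)}1\le u^{\rm T}(k)\,{}_a^{\rm R}\nabla_k^{\alpha,w(k)}v(k)+v^{\rm T}(k)\,{}_a^{\rm R}\nabla_k^{\alpha,w(k)}u(k),$$ $${}_a^{\rm G}\nabla_k^{\alpha,w(k)}[u^{\rm T}(k)v(k)]+[u^{\rm T}(k)v(k)]\,{}_a^{\rm G}\nabla_k^{\alpha,w(k)}1\le u^{\rm T}(k)\,{}_a^{\rm G}\nabla_k^{\alpha,w(k)}v(k)+v^{\rm T}(k)\,{}_a^{\rm G}\nabla_k^{\alpha,w(k)}u(k).$$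
   Context: For $a\in\mathbb{R}$, $\mathbb{N}_a:=\{a,a+1,a+2,\dots\}$. Functions $u,v:\mathbb{N}_a\to\mathbb{R}^n$ are synchronous if $[u(j)-u(k)]^{\rm T}[v(j)-v(k)]\ge 0$ for all $j,k\in\mathbb{N}_a$. The nabla difference is $\nabla x(k):=x(k)-x(k-1)$. For $\beta\in(-1,1)$, the Grünwald–Letnikov difference/sum is $${}_a^{\rm G}\nabla_k^{\beta}x(k):=\sum_{i=0}^{k-a-1}(-1)^i\binom{\beta}{i}x(k-i),\qquad \binom{p}{q}:=\frac{\Gamma(p+1)}{\Gamma(q+1)\Gamma(p-q+1)},$$ with the empty sum (at $k=a$) equal to $0$. For $\alpha\in(0,1)$ and $k\in\mathbb{N}_{a+1}$, ${}_a^{\rm R}\nabla_k^{\alpha}x(k):=\nabla\,{}_a^{\rm G}\nabla_k^{\alpha-1}x(k)$ (Riemann–Liouville) and ${}_a^{\rm C}\nabla_k^{\alpha}x(k):={}_a^{\rm G}\nabla_k^{\alpha-1}\nabla x(k)$ (Caputo). Given a tempered function $w$, for each ${\rm X}\in\{{\rm G},{\rm R},{\rm C}\}$ the tempered operator is ${}_a^{\rm X}\nabla_k^{\alpha,w(k)}x(k):=w^{-1}(k)\,{}_a^{\rm X}\nabla_k^{\alpha}[w(k)x(k)]$, where $w^{-1}(k)=1/w(k)$; on vector-valued sequences all operators act componentwise, and ${}_a^{\rm X}\nabla_k^{\alpha,w(k)}1$ is the operator applied to the constant sequence $1$. *)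

theory Defs
  imports "HOL-Analysis.Analysis"
begin

definition nat_from :: "real \<Rightarrow> real set" where
  "nat_from a = range (\<lambda>m::nat. a + real m)"

(* Sequences on nat_from a are represented by functions on all of real. At the points
   k \<in> nat_from (a + 1) the operators below only read values at points of nat_from a. *)

definition synchronous_on :: "real set \<Rightarrow> (real \<Rightarrow> 'b::real_inner) \<Rightarrow> (real \<Rightarrow> 'b) \<Rightarrow> bool" where
  "synchronous_on S u v \<longleftrightarrow> (\<forall>j\<in>S. \<forall>k\<in>S. (u j - u k) \<bullet> (v j - v k) \<ge> 0)"

definition nabla :: "(real \<Rightarrow> 'b::real_vector) \<Rightarrow> real \<Rightarrow> 'b" where
  "nabla x k = x k - x (k - 1)"

(* Gamma is 0 at its poles and division by 0 yields 0, so a pole of Gamma (p - q + 1)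
   gives the usual value 0. *)
definition Gamma_binomial :: "real \<Rightarrow> real \<Rightarrow> real" where
  "Gamma_binomial p q = Gamma (p + 1) / (Gamma (q + 1) * Gamma (p - q + 1))"

lemma Gamma_binomial_eq_gbinomial:
  assumes "p > -1"
  shows "Gamma_binomial p (real i) = p gchoose i"
proof -
  have "p + 1 \<notin> \<int>\<^sub>\<le>\<^sub>0"
    using assms by (auto elim!: nonpos_Ints_cases)
  then show ?thesis
    by (simp add: gbinomial_Gamma Gamma_binomial_def Gamma_fact add.commute)
qed

(* The operators are polymorphic in the value space: scaleR is multiplication on real
   and acts componentwise on real ^ 'n. *)

definition GL :: "real \<Rightarrow> real \<Rightarrow> (real \<Rightarrow> 'b::real_vector) \<Rightarrow> real \<Rightarrow> 'b" where
  "GL a \<beta> x k =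
     (\<Sum>i\<in>{i::nat. real i \<le> k - a - 1}.
        ((-1) ^ i * Gamma_binomial \<beta> (real i)) *\<^sub>R x (k - real i))"

definition RL :: "real \<Rightarrow> real \<Rightarrow> (real \<Rightarrow> 'b::real_vector) \<Rightarrow> real \<Rightarrow> 'b" where
  "RL a \<alpha> x k = nabla (GL a (\<alpha> - 1) x) k"

definition Caputo :: "real \<Rightarrow> real \<Rightarrow> (real \<Rightarrow> 'b::real_vector) \<Rightarrow> real \<Rightarrow> 'b" where
  "Caputo a \<alpha> x k = GL a (\<alpha> - 1) (nabla x) k"

definition tempered ::
  "((real \<Rightarrow> 'b::real_vector) \<Rightarrow> real \<Rightarrow> 'b) \<Rightarrow> (real \<Rightarrow> real) \<Rightarrow> (real \<Rightarrow> 'b) \<Rightarrow> real \<Rightarrow> 'b" where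
  "tempered D w x k = (1 / w k) *\<^sub>R D (\<lambda>j. w j *\<^sub>R x j) k"

lemma GL_component: "GL a \<beta> x k $ i = GL a \<beta> (\<lambda>j. x j $ i) k"
  by (simp add: GL_def)

lemma RL_component: "RL a \<alpha> x k $ i = RL a \<alpha> (\<lambda>j. x j $ i) k"
  by (simp add: RL_def nabla_def GL_component)

lemma Caputo_component: "Caputo a \<alpha> x k $ i = Caputo a \<alpha> (\<lambda>j. x j $ i) k"
  by (simp add: Caputo_def nabla_def [abs_def] GL_component)

lemma tempered_component:
  "tempered (GL a \<alpha>) w x k $ i = tempered (GL a \<alpha>) w (\<lambda>j. x j $ i) k"
  "tempered (RL a \<alpha>) w x k $ i = tempered (RL a \<alpha>) w (\<lambda>j. x j $ i) k"
  "tempered (Caputo a \<alpha>) w x k $ i = tempered (Caputo a \<alpha>) w (\<lambda>j. x j $ i) k"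
  by (simp_all add: tempered_def GL_component RL_component Caputo_component)

end

theory Submission
  imports Defs
begin

text \<open>
  Each of the three operators, evaluated at \<open>k = a + m\<close> with \<open>m \<ge> 1\<close>, is a finite
  combination \<open>\<Sum>\<^sub>i c\<^sub>i x(t\<^sub>i)\<close> of values of \<open>x\<close> at points \<open>t\<^sub>i\<close> of the grid, with
  \<open>t\<^sub>0 = k\<close> and \<open>c\<^sub>i \<le> 0\<close> for all \<open>i \<ge> 1\<close>. For such an operator the right-hand side minus
  the left-hand side of the product inequality is
  \<open>- (\<Sum>\<^sub>i c\<^sub>i (w(t\<^sub>i) / w(k)) (u(k) - u(t\<^sub>i)) \<bullet> (v(k) - v(t\<^sub>i)))\<close>,
  because \<open>u(t)\<bullet>v(t) + u(k)\<bullet>v(k) - u(k)\<bullet>v(t) - v(k)\<bullet>u(t) = (u(k) - u(t))\<bullet>(v(k) - v(t))\<close>.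
  The term of the point \<open>k\<close> itself vanishes, whatever the sign of its coefficient; the others
  are nonnegative by synchrony and because \<open>w\<close> has constant sign on the grid. This is
  \<open>tempered_product_inequality\<close>.

  It remains to compute the coefficients. Put \<open>g\<^sub>i(\<beta>) = (-1)\<^sup>i (\<beta> choose i)\<close>, which is the
  rising factorial of \<open>-\<beta>\<close> divided by \<open>i!\<close>; hence \<open>g\<^sub>i(\<alpha>) \<le> 0\<close> for \<open>i \<ge> 1\<close> and
  \<open>g\<^sub>i(\<alpha> - 1) \<ge> 0\<close>. Pascal's rule \<open>g\<^sub>i\<^sub>+\<^sub>1(\<alpha>) = g\<^sub>i\<^sub>+\<^sub>1(\<alpha> - 1) - g\<^sub>i(\<alpha> - 1)\<close> and summation by
  parts show that the Riemann--Liouville difference coincides with the Gruenwald--Letnikov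
  difference of the same order (\<open>RL_eq_GL\<close>), and that the Caputo difference only has the
  additional term \<open>- g\<^sub>m\<^sub>-\<^sub>1(\<alpha> - 1) x(a)\<close> (\<open>Caputo_eq_GL\<close>), whose coefficient is again nonpositive.
\<close>

section \<open>Signed binomial coefficients\<close>

definition signed_gbinomial :: "real \<Rightarrow> nat \<Rightarrow> real" where
  "signed_gbinomial \<beta> i = (-1) ^ i * (\<beta> gchoose i)"

lemma signed_gbinomial_0 [simp]: "signed_gbinomial \<beta> 0 = 1"
  by (simp add: signed_gbinomial_def)

lemma signed_gbinomial_pochhammer: "signed_gbinomial \<beta> i = pochhammer (- \<beta>) i / fact i"
  by (simp add: signed_gbinomial_def gbinomial_pochhammer flip: power_mult_distrib)

lemma signed_gbinomial_nonneg:
  assumes "\<beta> < 0"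
  shows "signed_gbinomial \<beta> i \<ge> 0"
  using assms by (simp add: signed_gbinomial_pochhammer pochhammer_pos less_imp_le)

text \<open>Only the first factor of the rising factorial of \<open>-\<beta>\<close> is negative.\<close>

lemma signed_gbinomial_Suc_nonpos:
  assumes "0 < \<beta>" "\<beta> < 1"
  shows "signed_gbinomial \<beta> (Suc i) \<le> 0"
proof -
  have "pochhammer (- \<beta> + 1) i > 0"
    using assms by (intro pochhammer_pos) simp
  then have "pochhammer (- \<beta>) (Suc i) \<le> 0"
    using assms by (simp add: pochhammer_rec)
  then show ?thesis
    unfolding signed_gbinomial_pochhammer by (intro divide_nonpos_pos) auto
qed

lemma signed_gbinomial_Pascal:
  "signed_gbinomial \<beta> (Suc i) = signed_gbinomial (\<beta> - 1) (Suc i) - signed_gbinomial (\<beta> - 1) i"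
  using gbinomial_Suc_Suc [of "\<beta> - 1" i] by (simp add: signed_gbinomial_def algebra_simps)

text \<open>Pascal's rule in the form of summation by parts: lowering the order of the coefficients
  by one is compensated by a backward difference. Both differences of order \<open>\<alpha>\<close> that are
  built from the sum of order \<open>\<alpha> - 1\<close> reduce to this identity.\<close>

lemma sum_signed_gbinomial_by_parts:
  fixes f :: "nat \<Rightarrow> 'b::real_vector"
  shows "(\<Sum>i<Suc m. signed_gbinomial (\<beta> - 1) i *\<^sub>R f i)
            - (\<Sum>i<m. signed_gbinomial (\<beta> - 1) i *\<^sub>R f (Suc i))
         = (\<Sum>i<Suc m. signed_gbinomial \<beta> i *\<^sub>R f i)"
  by (simp add: sum.lessThan_Suc_shift signed_gbinomial_Pascal [of \<beta>] scaleR_diff_left sum_subtractf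
      del: sum.lessThan_Suc)

section \<open>The operators as finite combinations of past values\<close>

lemma GL_at_grid:
  assumes "\<beta> > -1"
  shows "GL a \<beta> x (a + real m) = (\<Sum>i<m. signed_gbinomial \<beta> i *\<^sub>R x (a + real m - real i))"
proof -
  have "{i::nat. real i \<le> a + real m - a - 1} = {..<m}"
    by auto
  then show ?thesis
    using assms by (simp add: GL_def signed_gbinomial_def Gamma_binomial_eq_gbinomial)
qed

lemma RL_eq_GL:
  assumes "\<alpha> > 0"
  shows "RL a \<alpha> x (a + real (Suc m)) = GL a \<alpha> x (a + real (Suc m))"
proof -
  let ?d = "signed_gbinomial (\<alpha> - 1)" and ?f = "\<lambda>i. x (a + real (Suc m) - real i)"
  have prev: "GL a (\<alpha> - 1) x (a + real (Suc m) - 1) = (\<Sum>i<m. ?d i *\<^sub>R ?f (Suc i))"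
    using GL_at_grid [of "\<alpha> - 1" a x m] assms by (simp add: algebra_simps)
  have "RL a \<alpha> x (a + real (Suc m)) = (\<Sum>i<Suc m. ?d i *\<^sub>R ?f i) - (\<Sum>i<m. ?d i *\<^sub>R ?f (Suc i))"
    unfolding RL_def nabla_def prev by (subst GL_at_grid) (use assms in simp_all)
  also have "\<dots> = (\<Sum>i<Suc m. signed_gbinomial \<alpha> i *\<^sub>R ?f i)"
    by (rule sum_signed_gbinomial_by_parts)
  also have "\<dots> = GL a \<alpha> x (a + real (Suc m))"
    by (rule GL_at_grid [symmetric]) (use assms in simp)
  finally show ?thesis .
qed

text \<open>The difference inside the Caputo operator reaches one step further back than the sum
  inside the Riemann--Liouville one, down to \<open>x a\<close>; this gives the boundary term.\<close>

lemma Caputo_eq_GL: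
  assumes "\<alpha> > 0"
  shows "Caputo a \<alpha> x (a + real (Suc m))
         = GL a \<alpha> x (a + real (Suc m)) - signed_gbinomial (\<alpha> - 1) m *\<^sub>R x a"
proof -
  let ?d = "signed_gbinomial (\<alpha> - 1)" and ?f = "\<lambda>i. x (a + real (Suc m) - real i)"
  have "Caputo a \<alpha> x (a + real (Suc m)) = (\<Sum>i<Suc m. ?d i *\<^sub>R nabla x (a + real (Suc m) - real i))"
    unfolding Caputo_def by (rule GL_at_grid) (use assms in simp)
  also have "\<dots> = (\<Sum>i<Suc m. ?d i *\<^sub>R (?f i - ?f (Suc i)))"
    by (intro sum.cong refl) (simp add: nabla_def algebra_simps)
  also have "\<dots> = (\<Sum>i<Suc m. ?d i *\<^sub>R ?f i) - (\<Sum>i<m. ?d i *\<^sub>R ?f (Suc i)) - ?d m *\<^sub>R x a"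
    by (simp add: scaleR_diff_right sum_subtractf)
  also have "(\<Sum>i<Suc m. ?d i *\<^sub>R ?f i) - (\<Sum>i<m. ?d i *\<^sub>R ?f (Suc i))
      = (\<Sum>i<Suc m. signed_gbinomial \<alpha> i *\<^sub>R ?f i)"
    by (rule sum_signed_gbinomial_by_parts)
  also have "\<dots> = GL a \<alpha> x (a + real (Suc m))"
    by (rule GL_at_grid [symmetric]) (use assms in simp)
  finally show ?thesis .
qed

section \<open>The product inequality\<close>

text \<open>The operator acts on the scalar sequences \<open>u\<bullet>v\<close> and \<open>1\<close> as well as on the vector sequences
  \<open>u\<close> and \<open>v\<close>. Since a variable inside a statement has a single type, it enters as two
  operators \<open>D\<close> and \<open>E\<close> given by the same coefficients.\<close>

lemma tempered_product_inequality:
  fixes u v :: "real \<Rightarrow> 'b::real_inner"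
    and D :: "(real \<Rightarrow> real) \<Rightarrow> real \<Rightarrow> real"
    and E :: "(real \<Rightarrow> 'b) \<Rightarrow> real \<Rightarrow> 'b"
  assumes D: "\<And>x. D x k = (\<Sum>i\<in>I. c i *\<^sub>R x (t i))"
    and E: "\<And>x. E x k = (\<Sum>i\<in>I. c i *\<^sub>R x (t i))"
    and c: "\<And>i. i \<in> I \<Longrightarrow> t i \<noteq> k \<Longrightarrow> c i \<le> 0"
    and w: "\<And>i. i \<in> I \<Longrightarrow> w (t i) / w k \<ge> 0"
    and S: "synchronous_on S u v" "k \<in> S" "\<And>i. i \<in> I \<Longrightarrow> t i \<in> S"
  shows "tempered D w (\<lambda>j. u j \<bullet> v j) k + (u k \<bullet> v k) * tempered D w (\<lambda>_. 1) k
          \<le> u k \<bullet> tempered E w v k + v k \<bullet> tempered E w u k"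
proof -
  let ?c = "\<lambda>i. c i * (w (t i) / w k)"
  have D': "tempered D w x k = (\<Sum>i\<in>I. ?c i * x (t i))" for x
    unfolding tempered_def D by (simp add: sum_distrib_left mult.assoc mult.left_commute)
  have E': "y \<bullet> tempered E w x k = (\<Sum>i\<in>I. ?c i * (y \<bullet> x (t i)))" for x y
    unfolding tempered_def E
    by (simp add: inner_sum_right sum_distrib_left mult.assoc mult.left_commute)
  have "tempered D w (\<lambda>j. u j \<bullet> v j) k + (u k \<bullet> v k) * tempered D w (\<lambda>_. 1) k
          - (u k \<bullet> tempered E w v k + v k \<bullet> tempered E w u k)
        = (\<Sum>i\<in>I. ?c i * (u (t i) \<bullet> v (t i) + u k \<bullet> v k - u k \<bullet> v (t i) - v k \<bullet> u (t i)))"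
    unfolding D' E' by (simp add: sum_distrib_left sum.distrib sum_subtractf
        distrib_left right_diff_distrib mult.commute del: times_divide_eq_right)
  also have "\<dots> = (\<Sum>i\<in>I. ?c i * ((u k - u (t i)) \<bullet> (v k - v (t i))))"
    by (simp add: inner_diff_left inner_diff_right inner_commute algebra_simps)
  also have "\<dots> \<le> 0"
  proof (rule sum_nonpos)
    fix i assume i: "i \<in> I"
    show "c i * (w (t i) / w k) * ((u k - u (t i)) \<bullet> (v k - v (t i))) \<le> 0"
    proof (cases "t i = k")
      case False
      have "(u k - u (t i)) \<bullet> (v k - v (t i)) \<ge> 0"
        using S i by (auto simp: synchronous_on_def)
      then show ?thesis
        using c [OF i False] w [OF i] by (intro mult_nonpos_nonneg)
    qed simp
  qed
  finally show ?thesis by simp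
qed

theorem theorem3p11:
  fixes a \<alpha> :: real
    and w :: "real \<Rightarrow> real"
    and u v :: "real \<Rightarrow> real ^ 'n"
  assumes "0 < \<alpha>" and "\<alpha> < 1"
    and "\<forall>k\<in>nat_from a. w k \<noteq> 0"
    and "\<forall>k\<in>nat_from (a + 1). w a / w k > 0"
    and "synchronous_on (nat_from a) u v"
  shows "\<forall>k\<in>nat_from (a + 1).
      tempered (Caputo a \<alpha>) w (\<lambda>j. u j \<bullet> v j) k
          + (u k \<bullet> v k) * tempered (Caputo a \<alpha>) w (\<lambda>_. 1) k
        \<le> u k \<bullet> tempered (Caputo a \<alpha>) w v k + v k \<bullet> tempered (Caputo a \<alpha>) w u k
    \<and> tempered (RL a \<alpha>) w (\<lambda>j. u j \<bullet> v j) k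
          + (u k \<bullet> v k) * tempered (RL a \<alpha>) w (\<lambda>_. 1) k
        \<le> u k \<bullet> tempered (RL a \<alpha>) w v k + v k \<bullet> tempered (RL a \<alpha>) w u k
    \<and> tempered (GL a \<alpha>) w (\<lambda>j. u j \<bullet> v j) k
          + (u k \<bullet> v k) * tempered (GL a \<alpha>) w (\<lambda>_. 1) k
        \<le> u k \<bullet> tempered (GL a \<alpha>) w v k + v k \<bullet> tempered (GL a \<alpha>) w u k"
proof
  fix k assume "k \<in> nat_from (a + 1)"
  then obtain m where k: "k = a + real (Suc m)"
    by (auto simp: nat_from_def)
  let ?t = "\<lambda>i. k - real i" and ?g = "signed_gbinomial \<alpha>"
  have \<alpha>: "\<alpha> > 0" "\<alpha> > -1"
    using assms by auto
  have grid: "?t i \<in> nat_from a" if "i \<le> Suc m" for i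
    using that unfolding nat_from_def by (intro image_eqI [of _ _ "Suc m - i"]) (auto simp: k)
  have k_grid: "k \<in> nat_from a"
    using grid [of 0] by simp
  have w_a: "w a / w j > 0" if "j \<in> nat_from a" for j
  proof (cases "j = a")
    case True
    then show ?thesis using assms(3) that by auto
  next
    case False
    then obtain l where "j = a + real (Suc l)"
      using \<open>j \<in> nat_from a\<close> by (auto simp: nat_from_def gr0_conv_Suc)
    then have "j \<in> nat_from (a + 1)"
      by (auto simp: nat_from_def)
    then show ?thesis using assms(4) by auto
  qed
  have w_ratio: "w (?t i) / w k \<ge> 0" if "i \<le> Suc m" for i
    using w_a [OF grid [OF that]] w_a [OF k_grid] by (auto simp: zero_less_divide_iff zero_le_divide_iff)
  have g: "?g i \<le> 0" if "?t i \<noteq> k" for i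
    using that signed_gbinomial_Suc_nonpos assms(1,2) by (cases i) auto

  have GL: "GL a \<alpha> x k = (\<Sum>i<Suc m. ?g i *\<^sub>R x (?t i))" for x :: "real \<Rightarrow> 'x::real_vector"
    unfolding k by (rule GL_at_grid [OF \<alpha>(2)])
  have RL: "RL a \<alpha> x k = (\<Sum>i<Suc m. ?g i *\<^sub>R x (?t i))" for x :: "real \<Rightarrow> 'x::real_vector"
    using RL_eq_GL [OF \<alpha>(1), of a x m] GL [of x] by (simp add: k)
  \<comment> \<open>the boundary term of the Caputo difference is the term with index \<open>Suc m\<close>, as \<open>k - Suc m = a\<close>\<close>
  let ?h = "?g (Suc m := - signed_gbinomial (\<alpha> - 1) m)"
  have Caputo: "Caputo a \<alpha> x k = (\<Sum>i<Suc (Suc m). ?h i *\<^sub>R x (?t i))"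
    for x :: "real \<Rightarrow> 'x::real_vector"
  proof -
    have "(\<Sum>i<Suc m. ?h i *\<^sub>R x (?t i)) = (\<Sum>i<Suc m. ?g i *\<^sub>R x (?t i))"
      by (intro sum.cong) auto
    then show ?thesis
      using Caputo_eq_GL [OF \<alpha>(1), of a x m] GL [of x]
      by (simp add: k sum.lessThan_Suc [of _ "Suc m"] del: sum.lessThan_Suc)
  qed
  have h: "?h i \<le> 0" if "?t i \<noteq> k" for i
    using g [OF that] signed_gbinomial_nonneg [of "\<alpha> - 1" m] assms(2) by auto

  note ineq = tempered_product_inequality [where t = ?t and w = w, OF _ _ _ _ assms(5) k_grid]
  have Caputo_ineq: "tempered (Caputo a \<alpha>) w (\<lambda>j. u j \<bullet> v j) k
          + (u k \<bullet> v k) * tempered (Caputo a \<alpha>) w (\<lambda>_. 1) k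
        \<le> u k \<bullet> tempered (Caputo a \<alpha>) w v k + v k \<bullet> tempered (Caputo a \<alpha>) w u k"
    by (rule ineq [where c = ?h and I = "{..<Suc (Suc m)}"], rule Caputo, rule Caputo)
      (use h w_ratio grid in auto)
  have RL_ineq: "tempered (RL a \<alpha>) w (\<lambda>j. u j \<bullet> v j) k
          + (u k \<bullet> v k) * tempered (RL a \<alpha>) w (\<lambda>_. 1) k
        \<le> u k \<bullet> tempered (RL a \<alpha>) w v k + v k \<bullet> tempered (RL a \<alpha>) w u k"
    by (rule ineq [where c = ?g and I = "{..<Suc m}"], rule RL, rule RL)
      (use g w_ratio grid in auto)
  have GL_ineq: "tempered (GL a \<alpha>) w (\<lambda>j. u j \<bullet> v j) k
          + (u k \<bullet> v k) * tempered (GL a \<alpha>) w (\<lambda>_. 1) k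
        \<le> u k \<bullet> tempered (GL a \<alpha>) w v k + v k \<bullet> tempered (GL a \<alpha>) w u k"
    by (rule ineq [where c = ?g and I = "{..<Suc m}"], rule GL, rule GL)
      (use g w_ratio grid in auto)
  show "tempered (Caputo a \<alpha>) w (\<lambda>j. u j \<bullet> v j) k
          + (u k \<bullet> v k) * tempered (Caputo a \<alpha>) w (\<lambda>_. 1) k
        \<le> u k \<bullet> tempered (Caputo a \<alpha>) w v k + v k \<bullet> tempered (Caputo a \<alpha>) w u k
    \<and> tempered (RL a \<alpha>) w (\<lambda>j. u j \<bullet> v j) k
          + (u k \<bullet> v k) * tempered (RL a \<alpha>) w (\<lambda>_. 1) k
        \<le> u k \<bullet> tempered (RL a \<alpha>) w v k + v k \<bullet> tempered (RL a \<alpha>) w u k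
    \<and> tempered (GL a \<alpha>) w (\<lambda>j. u j \<bullet> v j) k
          + (u k \<bullet> v k) * tempered (GL a \<alpha>) w (\<lambda>_. 1) k
        \<le> u k \<bullet> tempered (GL a \<alpha>) w v k + v k \<bullet> tempered (GL a \<alpha>) w u k"
    by (intro conjI Caputo_ineq RL_ineq GL_ineq)
qed

end
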